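(* Let $\alpha\neq\beta$ be positive constants, let $c\neq0$ be a constant, let $J\subset(0,\infty)$ be an open interval, and let $M^2$ be the general rotational surface in $\mathbb R^4$ $$z(u,v)=\left(u\cos\alpha v,\;u\sin\alpha v,\;g(u)\cos\beta v,\;g(u)\sin\beta v\right),\quad g(u)=c\,u^{\beta^2/\alpha^2},\ u\in J,\ v\in[0,2\pi).$$ Then the parametric $v$-lines ($u=\mathrm{const}$) of $M^2$ are both asymptotic lines and principal lines of $M^2$, and they are helices in $\mathbb R^4$.
   Context: For a smooth regular surface $z=z(u,v)$ in Euclidean $\mathbb R^4$: $E,F,G$ are the coefficients of the first fundamental form, $W=\sqrt{EG-F^2}$. $\{e_1,e_2\}$ is an orthonormal normal frame field chosen so that $\{z_u,z_v,e_1,e_2\}$ is positively oriented in $\mathbb R^4$. $\sigma$ is the vector-valued second fundamental tensor (normal part of the second derivative). The oriented area of the parallelogram of an ordered pair of normal vectors is $S(a^1e_1+a^2e_2,\;b^1e_1+b^2e_2)=a^1b^2-a^2b^1$. Put $L=\frac{2}{W}S(\sigma(z_u,z_u),\sigma(z_u,z_v))$, $M=\frac{1}{W}S(\sigma(z_u,z_u),\sigma(z_v,z_v))$, $N=\frac{2}{W}S(\sigma(z_u,z_v),\sigma(z_v,z_v))$. A tangent at $p$ is a line in $T_pM^2$ determined by a nonzero vector $\lambda z_u+\mu z_v$. Two tangents determined by $\lambda_iz_u+\mu_iz_v$ ($i=1,2$) are conjugate if $L\lambda_1\lambda_2+M(\lambda_1\mu_2+\lambda_2\mu_1)+N\mu_1\mu_2=0$.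 A tangent is asymptotic if it is conjugate to itself. A tangent is principal if it is perpendicular to its conjugate, i.e. if there is a tangent conjugate to it and perpendicular to it. A curve on $M^2$ is an asymptotic line (respectively principal line) if its tangent at every point is asymptotic (respectively principal). A helix in $\mathbb R^4$ is a curve whose three Frenet curvatures in $\mathbb R^4$ are constant (here they are nonzero). *)

theory Defs
  imports "HOL-Analysis.Analysis"
begin

text \<open>A surface patch is a map \<open>z u v\<close> together with a parameter domain \<open>D\<close>.  All derivatives
  are taken relative to \<open>D\<close> (or to the parameter interval of a curve), so that half-open
  parameter intervals make sense and values of \<open>z\<close> outside \<open>D\<close> play no role.\<close>

type_synonym surface = "real \<Rightarrow> real \<Rightarrow> real^4"

definition partial_u :: "(real \<times> real) set \<Rightarrow> surface \<Rightarrow> surface" where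
  "partial_u D z u v = vector_derivative (\<lambda>s. z s v) (at u within {s. (s, v) \<in> D})"

definition partial_v :: "(real \<times> real) set \<Rightarrow> surface \<Rightarrow> surface" where
  "partial_v D z u v = vector_derivative (\<lambda>t. z u t) (at v within {t. (u, t) \<in> D})"

definition coeff_E :: "(real \<times> real) set \<Rightarrow> surface \<Rightarrow> real \<Rightarrow> real \<Rightarrow> real" where
  "coeff_E D z u v = partial_u D z u v \<bullet> partial_u D z u v"

definition coeff_F :: "(real \<times> real) set \<Rightarrow> surface \<Rightarrow> real \<Rightarrow> real \<Rightarrow> real" where
  "coeff_F D z u v = partial_u D z u v \<bullet> partial_v D z u v"

definition coeff_G :: "(real \<times> real) set \<Rightarrow> surface \<Rightarrow> real \<Rightarrow> real \<Rightarrow> real" where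
  "coeff_G D z u v = partial_v D z u v \<bullet> partial_v D z u v"

definition area_W :: "(real \<times> real) set \<Rightarrow> surface \<Rightarrow> real \<Rightarrow> real \<Rightarrow> real" where
  "area_W D z u v = sqrt (coeff_E D z u v * coeff_G D z u v - (coeff_F D z u v)\<^sup>2)"

definition tangent_plane :: "(real \<times> real) set \<Rightarrow> surface \<Rightarrow> real \<Rightarrow> real \<Rightarrow> (real^4) set" where
  "tangent_plane D z u v = span {partial_u D z u v, partial_v D z u v}"

definition normal_part ::
    "(real \<times> real) set \<Rightarrow> surface \<Rightarrow> real \<Rightarrow> real \<Rightarrow> real^4 \<Rightarrow> real^4" where
  "normal_part D z u v w =
     (THE n. (\<forall>x \<in> tangent_plane D z u v. orthogonal n x) \<and> w - n \<in> tangent_plane D z u v)"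

definition sigma_uu :: "(real \<times> real) set \<Rightarrow> surface \<Rightarrow> surface" where
  "sigma_uu D z u v = normal_part D z u v (partial_u D (partial_u D z) u v)"

definition sigma_uv :: "(real \<times> real) set \<Rightarrow> surface \<Rightarrow> surface" where
  "sigma_uv D z u v = normal_part D z u v (partial_v D (partial_u D z) u v)"

definition sigma_vv :: "(real \<times> real) set \<Rightarrow> surface \<Rightarrow> surface" where
  "sigma_vv D z u v = normal_part D z u v (partial_v D (partial_v D z) u v)"

text \<open>The determinant condition also forces the patch to be regular at the points of \<open>D\<close>.\<close>

definition positive_normal_frame ::
    "(real \<times> real) set \<Rightarrow> surface \<Rightarrow> surface \<Rightarrow> surface \<Rightarrow> bool" where
  "positive_normal_frame D z e1 e2 \<longleftrightarrow>
     (\<forall>(u, v) \<in> D.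
        norm (e1 u v) = 1 \<and> norm (e2 u v) = 1 \<and> orthogonal (e1 u v) (e2 u v) \<and>
        (\<forall>x \<in> tangent_plane D z u v. orthogonal (e1 u v) x \<and> orthogonal (e2 u v) x) \<and>
        det (vector [partial_u D z u v, partial_v D z u v, e1 u v, e2 u v] :: real^4^4) > 0)"

text \<open>For orthonormal \<open>a\<close>, \<open>b\<close> the inner products below are the coordinates of \<open>x\<close> and \<open>y\<close>.\<close>

definition oriented_area :: "real^4 \<Rightarrow> real^4 \<Rightarrow> real^4 \<Rightarrow> real^4 \<Rightarrow> real" where
  "oriented_area a b x y = (x \<bullet> a) * (y \<bullet> b) - (x \<bullet> b) * (y \<bullet> a)"

definition coeff_L ::
    "(real \<times> real) set \<Rightarrow> surface \<Rightarrow> surface \<Rightarrow> surface \<Rightarrow> real \<Rightarrow> real \<Rightarrow> real" where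
  "coeff_L D z e1 e2 u v =
     2 / area_W D z u v * oriented_area (e1 u v) (e2 u v) (sigma_uu D z u v) (sigma_uv D z u v)"

definition coeff_M ::
    "(real \<times> real) set \<Rightarrow> surface \<Rightarrow> surface \<Rightarrow> surface \<Rightarrow> real \<Rightarrow> real \<Rightarrow> real" where
  "coeff_M D z e1 e2 u v =
     1 / area_W D z u v * oriented_area (e1 u v) (e2 u v) (sigma_uu D z u v) (sigma_vv D z u v)"

definition coeff_N ::
    "(real \<times> real) set \<Rightarrow> surface \<Rightarrow> surface \<Rightarrow> surface \<Rightarrow> real \<Rightarrow> real \<Rightarrow> real" where
  "coeff_N D z e1 e2 u v =
     2 / area_W D z u v * oriented_area (e1 u v) (e2 u v) (sigma_uv D z u v) (sigma_vv D z u v)"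

text \<open>Tangents are lines, i.e. one-dimensional subspaces of the tangent plane.\<close>

definition determines_tangent ::
    "(real \<times> real) set \<Rightarrow> surface \<Rightarrow> real \<Rightarrow> real \<Rightarrow> real \<Rightarrow> real \<Rightarrow> (real^4) set \<Rightarrow> bool" where
  "determines_tangent D z u v l m g \<longleftrightarrow>
     (let w = l *\<^sub>R partial_u D z u v + m *\<^sub>R partial_v D z u v in w \<noteq> 0 \<and> g = span {w})"

definition conjugate_tangents ::
    "(real \<times> real) set \<Rightarrow> surface \<Rightarrow> surface \<Rightarrow> surface \<Rightarrow> real \<Rightarrow> real
       \<Rightarrow> (real^4) set \<Rightarrow> (real^4) set \<Rightarrow> bool" where
  "conjugate_tangents D z e1 e2 u v g h \<longleftrightarrow>
     (\<exists>l1 m1 l2 m2.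
        determines_tangent D z u v l1 m1 g \<and> determines_tangent D z u v l2 m2 h \<and>
        coeff_L D z e1 e2 u v * l1 * l2 + coeff_M D z e1 e2 u v * (l1 * m2 + l2 * m1)
          + coeff_N D z e1 e2 u v * m1 * m2 = 0)"

definition asymptotic_tangent ::
    "(real \<times> real) set \<Rightarrow> surface \<Rightarrow> surface \<Rightarrow> surface \<Rightarrow> real \<Rightarrow> real \<Rightarrow> (real^4) set \<Rightarrow> bool" where
  "asymptotic_tangent D z e1 e2 u v g \<longleftrightarrow> conjugate_tangents D z e1 e2 u v g g"

definition principal_tangent ::
    "(real \<times> real) set \<Rightarrow> surface \<Rightarrow> surface \<Rightarrow> surface \<Rightarrow> real \<Rightarrow> real \<Rightarrow> (real^4) set \<Rightarrow> bool" where
  "principal_tangent D z e1 e2 u v g \<longleftrightarrow>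
     (\<exists>h. conjugate_tangents D z e1 e2 u v g h \<and> (\<forall>x \<in> g. \<forall>y \<in> h. orthogonal x y))"

text \<open>A curve on the surface is given by its coordinate curve \<open>\<gamma>\<close> in the parameter domain.\<close>

definition surface_curve :: "surface \<Rightarrow> (real \<Rightarrow> real \<times> real) \<Rightarrow> real \<Rightarrow> real^4" where
  "surface_curve z \<gamma> t = z (fst (\<gamma> t)) (snd (\<gamma> t))"

definition asymptotic_line ::
    "(real \<times> real) set \<Rightarrow> surface \<Rightarrow> surface \<Rightarrow> surface
       \<Rightarrow> real set \<Rightarrow> (real \<Rightarrow> real \<times> real) \<Rightarrow> bool" where
  "asymptotic_line D z e1 e2 I \<gamma> \<longleftrightarrow>
     \<gamma> ` I \<subseteq> D \<and>
     (\<forall>t \<in> I. \<exists>w. (surface_curve z \<gamma> has_vector_derivative w) (at t within I) \<and>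
        asymptotic_tangent D z e1 e2 (fst (\<gamma> t)) (snd (\<gamma> t)) (span {w}))"

definition principal_line ::
    "(real \<times> real) set \<Rightarrow> surface \<Rightarrow> surface \<Rightarrow> surface
       \<Rightarrow> real set \<Rightarrow> (real \<Rightarrow> real \<times> real) \<Rightarrow> bool" where
  "principal_line D z e1 e2 I \<gamma> \<longleftrightarrow>
     \<gamma> ` I \<subseteq> D \<and>
     (\<forall>t \<in> I. \<exists>w. (surface_curve z \<gamma> has_vector_derivative w) (at t within I) \<and>
        principal_tangent D z e1 e2 (fst (\<gamma> t)) (snd (\<gamma> t)) (span {w}))"

text \<open>The Frenet equations of a curve in four-space for an arbitrary regular parameter; \<open>s\<close> is the
  speed.  The frame is a positively oriented orthonormal basis, so with the sign conditions on the
  first two curvatures the frame and the three curvatures are determined by the curve.\<close>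

definition frenet_curvatures ::
    "real set \<Rightarrow> (real \<Rightarrow> real^4) \<Rightarrow> (real \<Rightarrow> real) \<Rightarrow> (real \<Rightarrow> real) \<Rightarrow> (real \<Rightarrow> real) \<Rightarrow> bool" where
  "frenet_curvatures I x \<kappa>1 \<kappa>2 \<kappa>3 \<longleftrightarrow>
     (\<exists>s T N1 N2 B. \<forall>t \<in> I.
        s t > 0 \<and> \<kappa>1 t > 0 \<and> \<kappa>2 t > 0 \<and>
        rotation_matrix (vector [T t, N1 t, N2 t, B t] :: real^4^4) \<and>
        (x has_vector_derivative s t *\<^sub>R T t) (at t within I) \<and>
        (T has_vector_derivative s t *\<^sub>R (\<kappa>1 t *\<^sub>R N1 t)) (at t within I) \<and>
        (N1 has_vector_derivative s t *\<^sub>R (- \<kappa>1 t *\<^sub>R T t + \<kappa>2 t *\<^sub>R N2 t)) (at t within I) \<and>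
        (N2 has_vector_derivative s t *\<^sub>R (- \<kappa>2 t *\<^sub>R N1 t + \<kappa>3 t *\<^sub>R B t)) (at t within I) \<and>
        (B has_vector_derivative s t *\<^sub>R (- \<kappa>3 t *\<^sub>R N2 t)) (at t within I))"

definition helix :: "real set \<Rightarrow> (real \<Rightarrow> real^4) \<Rightarrow> bool" where
  "helix I x \<longleftrightarrow>
     (\<exists>k1 k2 k3. k1 \<noteq> 0 \<and> k2 \<noteq> 0 \<and> k3 \<noteq> 0 \<and>
        frenet_curvatures I x (\<lambda>_. k1) (\<lambda>_. k2) (\<lambda>_. k3))"

definition general_rotational_surface :: "real \<Rightarrow> real \<Rightarrow> (real \<Rightarrow> real) \<Rightarrow> surface" where
  "general_rotational_surface \<alpha> \<beta> g u v =
     vector [u * cos (\<alpha> * v), u * sin (\<alpha> * v), g u * cos (\<beta> * v), g u * sin (\<beta> * v)]"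

end

theory Submission
  imports Defs
begin

text \<open>
  Write \<open>g u = c u\<^sup>k\<close> with \<open>k = \<beta>\<^sup>2 / \<alpha>\<^sup>2\<close>.  Then \<open>\<alpha>\<^sup>2 u g' u = \<beta>\<^sup>2 g u\<close>, and this identity is
  the whole reason for the first two claims: differentiating twice along a \<open>v\<close>-line gives
  \<open>z\<^sub>v\<^sub>v = - \<alpha>\<^sup>2 u z\<^sub>u\<close>, a vector of the tangent plane.  Hence \<open>\<sigma>(z\<^sub>v, z\<^sub>v) = 0\<close>, and both
  coefficients \<open>M\<close> and \<open>N\<close>, being areas of parallelograms with \<open>\<sigma>(z\<^sub>v, z\<^sub>v)\<close> as a side, vanish
  for every normal frame.  From \<open>N = 0\<close> the direction \<open>z\<^sub>v\<close> is conjugate to itself; from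
  \<open>M = 0\<close> it is conjugate to \<open>z\<^sub>u\<close>, which is perpendicular to it because \<open>F = 0\<close>.

  A \<open>v\<close>-line is the orbit of a point \<open>(a, 0, b, 0)\<close> with \<open>a, b \<noteq> 0\<close> under the one-parameter group
  of rotations with angular speeds \<open>\<alpha>\<close> and \<open>\<beta>\<close> in two orthogonal planes.  It is therefore
  homogeneous and has constant curvatures.  To see that they do not vanish, an explicit
  Frenet frame is given (\<open>helix_double_rotation\<close>).  All vectors in sight lie in one of two families,
  the fields \<open>radial\<close> and \<open>angular\<close> carried along by the rotations.  The two families
  are orthogonal to each other, and differentiation exchanges them, so the Frenet equations reduce
  to identities between constants.
\<close>

section \<open>Vectors and matrices in four-space\<close>

lemma vector_4_nth [simp]:
  "(vector [a, b, c, d] :: 'a::zero^4) $ 1 = a"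
  "(vector [a, b, c, d] :: 'a::zero^4) $ 2 = b"
  "(vector [a, b, c, d] :: 'a::zero^4) $ 3 = c"
  "(vector [a, b, c, d] :: 'a::zero^4) $ 4 = d"
  by (simp_all add: vector_def)

lemma inner_4: "(x :: real^4) \<bullet> y = x$1 * y$1 + x$2 * y$2 + x$3 * y$3 + x$4 * y$4"
  by (simp add: inner_vec_def sum_4)

lemma has_vector_derivative_vector_4:
  assumes "(f1 has_vector_derivative d1) (at t within S)"
    and "(f2 has_vector_derivative d2) (at t within S)"
    and "(f3 has_vector_derivative d3) (at t within S)"
    and "(f4 has_vector_derivative d4) (at t within S)"
  shows "((\<lambda>t. vector [f1 t, f2 t, f3 t, f4 t] :: real^4)
           has_vector_derivative vector [d1, d2, d3, d4]) (at t within S)"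
  using assms
  unfolding has_vector_derivative_def has_derivative_componentwise_within[where 'b = "real^4"]
  by (simp add: Basis_vec_def inner_axis forall_4)

lemma det_4:
  "det (A :: 'a::comm_ring_1^4^4) =
     A$1$1 * (A$2$2 * (A$3$3 * A$4$4 - A$3$4 * A$4$3)
            - A$2$3 * (A$3$2 * A$4$4 - A$3$4 * A$4$2)
            + A$2$4 * (A$3$2 * A$4$3 - A$3$3 * A$4$2))
   - A$1$2 * (A$2$1 * (A$3$3 * A$4$4 - A$3$4 * A$4$3)
            - A$2$3 * (A$3$1 * A$4$4 - A$3$4 * A$4$1)
            + A$2$4 * (A$3$1 * A$4$3 - A$3$3 * A$4$1))
   + A$1$3 * (A$2$1 * (A$3$2 * A$4$4 - A$3$4 * A$4$2)
            - A$2$2 * (A$3$1 * A$4$4 - A$3$4 * A$4$1)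
            + A$2$4 * (A$3$1 * A$4$2 - A$3$2 * A$4$1))
   - A$1$4 * (A$2$1 * (A$3$2 * A$4$3 - A$3$3 * A$4$2)
            - A$2$2 * (A$3$1 * A$4$3 - A$3$3 * A$4$1)
            + A$2$3 * (A$3$1 * A$4$2 - A$3$2 * A$4$1))"
proof -
  have f1: "finite {2::4, 3, 4}" "1 \<notin> {2::4, 3, 4}" by auto
  have f2: "finite {3::4, 4}" "2 \<notin> {3::4, 4}" by auto
  have f3: "finite {4::4}" "3 \<notin> {4::4}" by auto
  show ?thesis
    unfolding det_def UNIV_4
    unfolding sum_over_permutations_insert[OF f1]
    unfolding sum_over_permutations_insert[OF f2]
    unfolding sum_over_permutations_insert[OF f3]
    unfolding permutes_sing
    by (simp add: sign_swap_id permutation_swap_id sign_compose permutation_compose sign_id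
        swap_id_eq algebra_simps)
qed

section \<open>Fields carried along by a double rotation\<close>

definition radial :: "real \<Rightarrow> real \<Rightarrow> real \<Rightarrow> real \<Rightarrow> real \<Rightarrow> real^4" where
  "radial \<alpha> \<beta> x y v = vector [x * cos (\<alpha> * v), x * sin (\<alpha> * v), y * cos (\<beta> * v), y * sin (\<beta> * v)]"

definition angular :: "real \<Rightarrow> real \<Rightarrow> real \<Rightarrow> real \<Rightarrow> real \<Rightarrow> real^4" where
  "angular \<alpha> \<beta> x y v =
     vector [- x * sin (\<alpha> * v), x * cos (\<alpha> * v), - y * sin (\<beta> * v), y * cos (\<beta> * v)]"

lemma radial_derivative:
  "(radial \<alpha> \<beta> x y has_vector_derivative angular \<alpha> \<beta> (\<alpha> * x) (\<beta> * y) v) (at v within S)"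
  unfolding radial_def[abs_def] angular_def
  by (intro has_vector_derivative_vector_4)
    (auto intro!: derivative_eq_intros simp: has_real_derivative_iff_has_vector_derivative[symmetric])

lemma angular_derivative:
  "(angular \<alpha> \<beta> x y has_vector_derivative radial \<alpha> \<beta> (- \<alpha> * x) (- \<beta> * y) v) (at v within S)"
  unfolding angular_def[abs_def] radial_def
  by (intro has_vector_derivative_vector_4)
    (auto intro!: derivative_eq_intros simp: has_real_derivative_iff_has_vector_derivative[symmetric])

lemma radial_derivative_coefficients:
  assumes "(f has_real_derivative f') (at u within S)" "(g has_real_derivative g') (at u within S)"
  shows "((\<lambda>s. radial \<alpha> \<beta> (f s) (g s) v) has_vector_derivative radial \<alpha> \<beta> f' g' v) (at u within S)"
  unfolding radial_def
  by (intro has_vector_derivative_vector_4)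
    (auto intro!: derivative_eq_intros assms
      simp: has_real_derivative_iff_has_vector_derivative[symmetric])

lemma scaleR_radial: "r *\<^sub>R radial \<alpha> \<beta> x y v = radial \<alpha> \<beta> (r * x) (r * y) v"
  by (simp add: vec_eq_iff forall_4 radial_def)

lemma scaleR_angular: "r *\<^sub>R angular \<alpha> \<beta> x y v = angular \<alpha> \<beta> (r * x) (r * y) v"
  by (simp add: vec_eq_iff forall_4 angular_def)

lemma add_radial:
  "radial \<alpha> \<beta> x y v + radial \<alpha> \<beta> x' y' v = radial \<alpha> \<beta> (x + x') (y + y') v"
  by (simp add: vec_eq_iff forall_4 radial_def algebra_simps)

lemma add_angular:
  "angular \<alpha> \<beta> x y v + angular \<alpha> \<beta> x' y' v = angular \<alpha> \<beta> (x + x') (y + y') v"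
  by (simp add: vec_eq_iff forall_4 angular_def algebra_simps)

lemma inner_radial_radial: "radial \<alpha> \<beta> x y v \<bullet> radial \<alpha> \<beta> x' y' v = x * x' + y * y'"
proof -
  have "radial \<alpha> \<beta> x y v \<bullet> radial \<alpha> \<beta> x' y' v
      = x * x' * ((cos (\<alpha> * v))\<^sup>2 + (sin (\<alpha> * v))\<^sup>2) + y * y' * ((cos (\<beta> * v))\<^sup>2 + (sin (\<beta> * v))\<^sup>2)"
    unfolding inner_4 radial_def vector_4_nth power2_eq_square by (simp only: algebra_simps)
  then show ?thesis by simp
qed

lemma inner_angular_angular: "angular \<alpha> \<beta> x y v \<bullet> angular \<alpha> \<beta> x' y' v = x * x' + y * y'"
proof -
  have "angular \<alpha> \<beta> x y v \<bullet> angular \<alpha> \<beta> x' y' v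
      = x * x' * ((cos (\<alpha> * v))\<^sup>2 + (sin (\<alpha> * v))\<^sup>2) + y * y' * ((cos (\<beta> * v))\<^sup>2 + (sin (\<beta> * v))\<^sup>2)"
    unfolding inner_4 angular_def vector_4_nth power2_eq_square by (simp only: algebra_simps)
  then show ?thesis by simp
qed

lemma inner_radial_angular: "radial \<alpha> \<beta> x y v \<bullet> angular \<alpha> \<beta> x' y' v = 0"
  by (simp add: inner_4 radial_def angular_def algebra_simps)

lemmas inner_fields = inner_radial_radial inner_angular_angular inner_radial_angular
  inner_radial_angular[unfolded inner_commute[of "radial _ _ _ _ _"]]

text \<open>Rotations preserve the determinant, so the value is that at \<open>v = 0\<close>.  There the angular
  vectors lie in the plane of the second and fourth axes and the radial ones in that of the first
  and third, so the determinant splits into two of order two; the signs of the two reorderings,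
  of rows and of columns, cancel.\<close>

lemma det_fields:
  "det (vector [angular \<alpha> \<beta> p q v, radial \<alpha> \<beta> x y v, angular \<alpha> \<beta> p' q' v, radial \<alpha> \<beta> x' y' v] :: real^4^4)
     = (p * q' - q * p') * (x * y' - y * x')"
proof -
  define C S C' S' where "C = cos (\<alpha> * v)" "S = sin (\<alpha> * v)" "C' = cos (\<beta> * v)" "S' = sin (\<beta> * v)"
  have "det (vector [angular \<alpha> \<beta> p q v, radial \<alpha> \<beta> x y v, angular \<alpha> \<beta> p' q' v, radial \<alpha> \<beta> x' y' v] :: real^4^4)
     = (p * q' - q * p') * (x * y' - y * x') * (C\<^sup>2 + S\<^sup>2) * (C'\<^sup>2 + S'\<^sup>2)"
    unfolding det_4 radial_def angular_def vector_4_nth C_S_C'_S'_def[symmetric] by algebra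
  then show ?thesis by (simp add: C_S_C'_S'_def)
qed

section \<open>Orbits of a double rotation are helices\<close>

text \<open>Dividing the velocity by the speed \<open>s\<close> and the acceleration by its length \<open>P\<close> yields unit
  coefficient pairs \<open>(p, q)\<close> and \<open>(r, t)\<close>, with \<open>T\<close> angular and \<open>N1\<close> radial; turning each pair by
  a right angle yields \<open>N2\<close> and \<open>B\<close>.  The sign \<open>e\<close> makes the second curvature positive; taking
  the same sign for \<open>N2\<close> and for \<open>B\<close> makes the frame positively oriented.\<close>

lemma helix_double_rotation:
  assumes ab: "\<alpha> > 0" "\<beta> > 0" "\<alpha> \<noteq> \<beta>" and nz: "a \<noteq> 0" "b \<noteq> 0"
  shows "helix I (radial \<alpha> \<beta> a b)"
proof -
  define s where "s = sqrt (\<alpha>\<^sup>2 * a\<^sup>2 + \<beta>\<^sup>2 * b\<^sup>2)"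
  define P where "P = sqrt (\<alpha>^4 * a\<^sup>2 + \<beta>^4 * b\<^sup>2)"
  define \<Delta> where "\<Delta> = \<alpha> * \<beta> * a * b * (\<alpha>\<^sup>2 - \<beta>\<^sup>2)"
  define e where "e = sgn \<Delta>"
  have pos: "\<alpha>\<^sup>2 * a\<^sup>2 + \<beta>\<^sup>2 * b\<^sup>2 > 0" "\<alpha>^4 * a\<^sup>2 + \<beta>^4 * b\<^sup>2 > 0"
    using ab nz by (auto intro!: add_pos_pos mult_pos_pos)
  have s: "s > 0" "s * s = \<alpha>\<^sup>2 * a\<^sup>2 + \<beta>\<^sup>2 * b\<^sup>2" and P: "P > 0" "P * P = \<alpha>^4 * a\<^sup>2 + \<beta>^4 * b\<^sup>2"
    using pos by (auto simp: s_def P_def)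
  have "\<alpha>\<^sup>2 \<noteq> \<beta>\<^sup>2"
    using ab by (simp add: power2_eq_iff_nonneg)
  then have "\<Delta> \<noteq> 0"
    using ab nz by (simp add: \<Delta>_def)
  then have e: "e * e = 1" "e * \<Delta> > 0"
    by (auto simp: e_def sgn_if)
  define p q r t where "p = \<alpha> * a / s" "q = \<beta> * b / s" "r = \<alpha>\<^sup>2 * a / P" "t = \<beta>\<^sup>2 * b / P"
  note pqrt = p_q_r_t_def
  have unit: "p * p + q * q = 1" "r * r + t * t = 1"
  proof -
    have "p * p + q * q = (\<alpha>\<^sup>2 * a\<^sup>2 + \<beta>\<^sup>2 * b\<^sup>2) / (s * s)"
      by (simp add: pqrt power2_eq_square add_divide_distrib mult_ac)
    then show "p * p + q * q = 1"
      using s pos by simp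
    have "r * r + t * t = (\<alpha>^4 * a\<^sup>2 + \<beta>^4 * b\<^sup>2) / (P * P)"
      by (simp add: pqrt power2_eq_square power4_eq_xxxx add_divide_distrib mult_ac)
    then show "r * r + t * t = 1"
      using P pos by simp
  qed
  define T N1 N2 B where "T = angular \<alpha> \<beta> p q" "N1 = radial \<alpha> \<beta> (- r) (- t)"
    "N2 = angular \<alpha> \<beta> (- e * q) (e * p)" "B = radial \<alpha> \<beta> (e * t) (- e * r)"
  note frame = T_N1_N2_B_def
  define k1 k2 k3 where "k1 = P / s\<^sup>2" "k2 = e * \<Delta> / (P * s\<^sup>2)" "k3 = \<alpha> * \<beta> / P"
  note curvatures = k1_k2_k3_def
  have kpos: "k1 > 0" "k2 > 0" "k3 > 0"
    using s P e ab by (auto simp: curvatures)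
  have ortho: "rotation_matrix (vector [T v, N1 v, N2 v, B v] :: real^4^4)" for v
  proof -
    have "det (vector [T v, N1 v, N2 v, B v] :: real^4^4)
        = (e * e) * (p * p + q * q) * (r * r + t * t)"
      unfolding frame det_fields by algebra
    then have "det (vector [T v, N1 v, N2 v, B v] :: real^4^4) = 1"
      by (simp add: unit e)
    moreover have "orthogonal_matrix (vector [T v, N1 v, N2 v, B v] :: real^4^4)"
    proof -
      have rows: "row 1 (vector [T v, N1 v, N2 v, B v] :: real^4^4) = T v"
        "row 2 (vector [T v, N1 v, N2 v, B v] :: real^4^4) = N1 v"
        "row 3 (vector [T v, N1 v, N2 v, B v] :: real^4^4) = N2 v"
        "row 4 (vector [T v, N1 v, N2 v, B v] :: real^4^4) = B v"
        by (simp_all add: row_def vec_eq_iff)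
      have ee: "e * (e * x) = x" for x
        using e(1) by (simp flip: mult.assoc)
      show ?thesis
        unfolding orthogonal_matrix_orthonormal_rows forall_4 rows norm_eq_1 orthogonal_def
        unfolding frame
        using unit by (simp add: inner_fields ee algebra_simps)
    qed
    ultimately show ?thesis by (simp add: rotation_matrix_def)
  qed
  \<comment> \<open>The five Frenet equations, read off on coefficient pairs.\<close>
  have c1: "\<alpha> * a = s * p" "\<beta> * b = s * q"
    using s(1) by (simp_all add: pqrt)
  have c2: "\<alpha> * p = s * (k1 * r)" "\<beta> * q = s * (k1 * t)"
    using s(1) P(1) by (simp_all add: pqrt curvatures power2_eq_square)
  have c3: "\<alpha> * r = s * (k1 * p + k2 * (e * q))" "\<beta> * t = s * (k1 * q - k2 * (e * p))"
  proof -
    have "s * (k1 * p + k2 * (e * q)) = ((P * P) * (\<alpha> * a) + (e * e) * \<Delta> * (\<beta> * b)) / (P * (s * s))"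
      using s(1) P(1) by (simp add: pqrt curvatures power2_eq_square
          distrib_left right_diff_distrib add_divide_distrib diff_divide_distrib mult_ac)
    also have "(P * P) * (\<alpha> * a) + (e * e) * \<Delta> * (\<beta> * b) = (\<alpha>^3 * a) * (s * s)"
      unfolding s P e \<Delta>_def by algebra
    finally show "\<alpha> * r = s * (k1 * p + k2 * (e * q))"
      using s(1) P(1) by (simp add: pqrt power2_eq_square power3_eq_cube)
    have "s * (k1 * q - k2 * (e * p)) = ((P * P) * (\<beta> * b) - (e * e) * \<Delta> * (\<alpha> * a)) / (P * (s * s))"
      using s(1) P(1) by (simp add: pqrt curvatures power2_eq_square
          distrib_left right_diff_distrib add_divide_distrib diff_divide_distrib mult_ac)
    also have "(P * P) * (\<beta> * b) - (e * e) * \<Delta> * (\<alpha> * a) = (\<beta>^3 * b) * (s * s)"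
      unfolding s P e \<Delta>_def by algebra
    finally show "\<beta> * t = s * (k1 * q - k2 * (e * p))"
      using s(1) P(1) by (simp add: pqrt power2_eq_square power3_eq_cube)
  qed
  have c4: "\<alpha> * (e * q) = s * (k2 * r + k3 * (e * t))" "\<beta> * (e * p) = s * (- k2 * t + k3 * (e * r))"
  proof -
    have "s * (k2 * r + k3 * (e * t)) = e * (\<Delta> * (\<alpha>\<^sup>2 * a) + \<alpha> * \<beta> * (\<beta>\<^sup>2 * b) * (s * s)) / ((P * P) * s)"
      using s(1) P(1) by (simp add: pqrt curvatures power2_eq_square
          distrib_left right_diff_distrib add_divide_distrib diff_divide_distrib mult_ac)
    also have "\<Delta> * (\<alpha>\<^sup>2 * a) + \<alpha> * \<beta> * (\<beta>\<^sup>2 * b) * (s * s) = \<alpha> * \<beta> * b * (P * P)"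
      unfolding s P \<Delta>_def by algebra
    finally show "\<alpha> * (e * q) = s * (k2 * r + k3 * (e * t))"
      using s(1) P(1) by (simp add: pqrt)
    have "s * (- k2 * t + k3 * (e * r)) = e * (\<alpha> * \<beta> * (\<alpha>\<^sup>2 * a) * (s * s) - \<Delta> * (\<beta>\<^sup>2 * b)) / ((P * P) * s)"
      using s(1) P(1) by (simp add: pqrt curvatures power2_eq_square
          distrib_left right_diff_distrib add_divide_distrib diff_divide_distrib mult_ac)
    also have "\<alpha> * \<beta> * (\<alpha>\<^sup>2 * a) * (s * s) - \<Delta> * (\<beta>\<^sup>2 * b) = \<alpha> * \<beta> * a * (P * P)"
      unfolding s P \<Delta>_def by algebra
    finally show "\<beta> * (e * p) = s * (- k2 * t + k3 * (e * r))"
      using s(1) P(1) by (simp add: pqrt)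
  qed
  have c5: "\<alpha> * t = s * (k3 * q)" "\<beta> * r = s * (k3 * p)"
    using s(1) P(1) by (simp_all add: pqrt curvatures power2_eq_square)
  have "frenet_curvatures I (radial \<alpha> \<beta> a b) (\<lambda>_. k1) (\<lambda>_. k2) (\<lambda>_. k3)"
    unfolding frenet_curvatures_def
  proof (rule exI[of _ "\<lambda>_. s"], rule exI[of _ T], rule exI[of _ N1], rule exI[of _ N2],
      rule exI[of _ B], intro ballI conjI)
    fix v
    show "rotation_matrix (vector [T v, N1 v, N2 v, B v] :: real^4^4)" by (rule ortho)
    show "(radial \<alpha> \<beta> a b has_vector_derivative s *\<^sub>R T v) (at v within I)"
      using radial_derivative[of \<alpha> \<beta> a b v I] by (simp add: frame scaleR_angular c1)
    show "(T has_vector_derivative s *\<^sub>R (k1 *\<^sub>R N1 v)) (at v within I)"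
      using angular_derivative[of \<alpha> \<beta> p q v I] by (simp add: frame scaleR_radial c2)
    show "(N1 has_vector_derivative s *\<^sub>R (- k1 *\<^sub>R T v + k2 *\<^sub>R N2 v)) (at v within I)"
      using radial_derivative[of \<alpha> \<beta> "- r" "- t" v I]
      by (simp only: frame scaleR_angular add_angular mult_minus_right c3) (simp add: algebra_simps)
    show "(N2 has_vector_derivative s *\<^sub>R (- k2 *\<^sub>R N1 v + k3 *\<^sub>R B v)) (at v within I)"
      using angular_derivative[of \<alpha> \<beta> "- (e * q)" "e * p" v I]
      by (simp only: frame scaleR_radial add_radial mult_minus_right mult_minus_left c4) (simp add: algebra_simps)
    show "(B has_vector_derivative s *\<^sub>R (- k3 *\<^sub>R N2 v)) (at v within I)"
      using radial_derivative[of \<alpha> \<beta> "e * t" "- (e * r)" v I]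
        c5
      by (simp add: frame scaleR_angular mult.left_commute[of _ e])
  qed (simp_all only: s(1) kpos)
  then show ?thesis
    unfolding helix_def using kpos by (intro exI[of _ k1] exI[of _ k2] exI[of _ k3]) simp
qed

section \<open>The second fundamental tensor along the parallels\<close>

text \<open>The description by a unique vector is justified here since a tangent vector which is
  orthogonal to the tangent plane is zero.\<close>

lemma normal_part_tangent:
  assumes "w \<in> tangent_plane D z u v"
  shows "normal_part D z u v w = 0"
  unfolding normal_part_def
proof (rule the_equality)
  fix n
  assume n: "(\<forall>x\<in>tangent_plane D z u v. orthogonal n x) \<and> w - n \<in> tangent_plane D z u v"
  then have "w - (w - n) \<in> tangent_plane D z u v"
    using assms unfolding tangent_plane_def by (blast intro: span_diff)
  then have "n \<in> tangent_plane D z u v"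
    by simp
  then show "n = 0"
    using n orthogonal_self[of n] by blast
qed (use assms in \<open>auto simp: orthogonal_def\<close>)

lemma coefficients_vanish:
  assumes "sigma_vv D z u v = 0"
  shows "coeff_M D z e1 e2 u v = 0" "coeff_N D z e1 e2 u v = 0"
  using assms by (simp_all add: coeff_M_def coeff_N_def oriented_area_def)

lemma v_tangent_asymptotic:
  assumes "coeff_N D z e1 e2 u v = 0" "partial_v D z u v \<noteq> 0"
  shows "asymptotic_tangent D z e1 e2 u v (span {partial_v D z u v})"
  unfolding asymptotic_tangent_def conjugate_tangents_def determines_tangent_def Let_def
  using assms by (intro exI[of _ 0] exI[of _ 1]) simp

lemma v_tangent_principal:
  assumes "coeff_M D z e1 e2 u v = 0" "coeff_F D z u v = 0"
    and "partial_u D z u v \<noteq> 0" "partial_v D z u v \<noteq> 0"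
  shows "principal_tangent D z e1 e2 u v (span {partial_v D z u v})"
  unfolding principal_tangent_def
proof (intro exI conjI)
  show "conjugate_tangents D z e1 e2 u v (span {partial_v D z u v}) (span {partial_u D z u v})"
    unfolding conjugate_tangents_def determines_tangent_def Let_def
    using assms
    by - (rule exI[of _ 0], rule exI[of _ 1], rule exI[of _ 1], rule exI[of _ 0], simp)
  show "\<forall>x\<in>span {partial_v D z u v}. \<forall>y\<in>span {partial_u D z u v}. orthogonal x y"
    using assms(2)
    by (auto simp: span_singleton orthogonal_def coeff_F_def inner_commute)
qed

lemma at_within_Ico_neq_bot:
  fixes x a b :: real
  assumes "x \<in> {a..<b}"
  shows "at x within {a..<b} \<noteq> bot"
proof -
  have "infinite {a..<b}"
    using assms by (simp add: infinite_Ico)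
  then have "{a..<b} \<noteq> {y}" for y
    by (metis finite.emptyI finite.insertI)
  then have "x islimpt {a..<b}"
    by (intro connected_imp_perfect assms connected_Ico)
  then show ?thesis by (simp add: trivial_limit_within)
qed

theorem mainTheorem9:
  fixes \<alpha> \<beta> c :: real and J :: "real set" and D :: "(real \<times> real) set"
    and z e1 e2 :: surface
  assumes "\<alpha> > 0" and "\<beta> > 0" and "\<alpha> \<noteq> \<beta>" and "c \<noteq> 0"
    and "open J" and "is_interval J" and "J \<noteq> {}" and "J \<subseteq> {0<..}"
    and "z = general_rotational_surface \<alpha> \<beta> (\<lambda>u. c * u powr (\<beta>\<^sup>2 / \<alpha>\<^sup>2))"
    and "D = J \<times> {0..<2 * pi}"
    and "positive_normal_frame D z e1 e2"
  shows "\<forall>u \<in> J.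
           asymptotic_line D z e1 e2 {0..<2 * pi} (\<lambda>v. (u, v)) \<and>
           principal_line D z e1 e2 {0..<2 * pi} (\<lambda>v. (u, v)) \<and>
           helix {0..<2 * pi} (surface_curve z (\<lambda>v. (u, v)))"
proof (intro ballI conjI)
  fix u assume u: "u \<in> J"
  then have "u > 0" using assms(8) by auto
  define k where "k = \<beta>\<^sup>2 / \<alpha>\<^sup>2"
  define g where "g = (\<lambda>u. c * u powr k)"
  let ?I = "{0..<2 * pi}"
  let ?g' = "k * g u / u"
  have z: "z = (\<lambda>u v. radial \<alpha> \<beta> u (g u) v)"
    unfolding assms(9) general_rotational_surface_def radial_def g_def k_def by simp
  have g': "(g has_real_derivative ?g') (at u within J)"
    unfolding g_def using \<open>u > 0\<close>
    by (auto intro!: derivative_eq_intros simp: powr_diff)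
  have "g u \<noteq> 0" using \<open>u > 0\<close> assms(4) by (simp add: g_def)
  have z_u: "partial_u D z u v = radial \<alpha> \<beta> 1 ?g' v" if "v \<in> ?I" for v
  proof -
    have "{s. (s, v) \<in> D} = J" using that by (auto simp: assms(10))
    moreover have "at u within J \<noteq> bot"
      using at_within_open[OF u assms(5)] by simp
    ultimately show ?thesis
      unfolding partial_u_def z
      using vector_derivative_within[OF _ radial_derivative_coefficients[OF DERIV_ident g']] by simp
  qed
  have slice: "{t. (u, t) \<in> D} = ?I" using u by (auto simp: assms(10))
  have z_v: "partial_v D z u v = angular \<alpha> \<beta> (\<alpha> * u) (\<beta> * g u) v" if "v \<in> ?I" for v
    unfolding partial_v_def slice z
    by (intro vector_derivative_within at_within_Ico_neq_bot that radial_derivative)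
  have z_vv: "partial_v D (partial_v D z) u v = (- \<alpha>\<^sup>2 * u) *\<^sub>R partial_u D z u v" if "v \<in> ?I" for v
  proof -
    have "(partial_v D z u has_vector_derivative
        radial \<alpha> \<beta> (- \<alpha> * (\<alpha> * u)) (- \<beta> * (\<beta> * g u)) v) (at v within ?I)"
      using that z_v
      by (intro has_vector_derivative_transform[OF _ _ angular_derivative]) auto
    then have "partial_v D (partial_v D z) u v
        = radial \<alpha> \<beta> (- \<alpha> * (\<alpha> * u)) (- \<beta> * (\<beta> * g u)) v"
      unfolding partial_v_def[of D "partial_v D z"] slice
      by (intro vector_derivative_within at_within_Ico_neq_bot that)
    also have "\<dots> = (- \<alpha>\<^sup>2 * u) *\<^sub>R radial \<alpha> \<beta> 1 ?g' v"
      using \<open>u > 0\<close> assms(1) by (simp add: scaleR_radial k_def power2_eq_square mult.assoc)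
    finally show ?thesis using z_u[OF that] by simp
  qed
  have sigma: "sigma_vv D z u v = 0" if "v \<in> ?I" for v
    unfolding sigma_vv_def z_vv[OF that] tangent_plane_def
    by (intro normal_part_tangent) (simp only: tangent_plane_def span_mul span_base insertI1)
  have F: "coeff_F D z u v = 0" if "v \<in> ?I" for v
    by (simp add: coeff_F_def z_u[OF that] z_v[OF that] inner_radial_angular)
  have nz_u: "partial_u D z u v \<noteq> 0" if "v \<in> ?I" for v
  proof -
    have "partial_u D z u v \<bullet> partial_u D z u v > 0"
      unfolding z_u[OF that] inner_fields by (simp add: add_pos_nonneg)
    then show ?thesis by auto
  qed
  have nz_v: "partial_v D z u v \<noteq> 0" if "v \<in> ?I" for v
  proof -
    have "partial_v D z u v \<bullet> partial_v D z u v > 0"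
      unfolding z_v[OF that] inner_fields using assms(1) \<open>u > 0\<close> by (simp add: add_pos_nonneg)
    then show ?thesis by auto
  qed
  have curve: "surface_curve z (\<lambda>v. (u, v)) = radial \<alpha> \<beta> u (g u)"
    by (simp add: fun_eq_iff surface_curve_def z)
  have velocity: "(surface_curve z (\<lambda>v. (u, v)) has_vector_derivative partial_v D z u v) (at v within ?I)"
    if "v \<in> ?I" for v
    unfolding curve z_v[OF that] by (rule radial_derivative)
  have in_D: "(\<lambda>v. (u, v)) ` ?I \<subseteq> D" using u by (auto simp: assms(10))
  show "asymptotic_line D z e1 e2 ?I (\<lambda>v. (u, v))"
    unfolding asymptotic_line_def fst_conv snd_conv
  proof (intro conjI ballI exI in_D)
    fix v assume v: "v \<in> ?I"
    show "(surface_curve z (\<lambda>v. (u, v)) has_vector_derivative partial_v D z u v) (at v within ?I)"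
      by (rule velocity[OF v])
    show "asymptotic_tangent D z e1 e2 u v (span {partial_v D z u v})"
      by (rule v_tangent_asymptotic[OF coefficients_vanish(2)[OF sigma[OF v]] nz_v[OF v]])
  qed
  show "principal_line D z e1 e2 ?I (\<lambda>v. (u, v))"
    unfolding principal_line_def fst_conv snd_conv
  proof (intro conjI ballI exI in_D)
    fix v assume v: "v \<in> ?I"
    show "(surface_curve z (\<lambda>v. (u, v)) has_vector_derivative partial_v D z u v) (at v within ?I)"
      by (rule velocity[OF v])
    show "principal_tangent D z e1 e2 u v (span {partial_v D z u v})"
      by (rule v_tangent_principal[OF coefficients_vanish(1)[OF sigma[OF v]] F[OF v] nz_u[OF v] nz_v[OF v]])
  qed
  show "helix ?I (surface_curve z (\<lambda>v. (u, v)))"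
    unfolding curve using assms(1-3) \<open>u > 0\<close> \<open>g u \<noteq> 0\<close> by (intro helix_double_rotation) auto
qed

end
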